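(* Let $\alpha = A/B \in \mathbb{Q}_{>0}$ with coprime positive integers $A, B$. For $y \in [0,1)$ let $F_\alpha(y) = \int_0^y \frac{\mathrm{d}s}{1 - s^{A/B}}$, and put $u = y^{1/B}$. Then $$F_{\alpha}(y) = -\sum_{k=1}^{\lfloor (B-1)/A \rfloor} \frac{B \, u^{B - kA}}{B - kA} - \frac{B}{A} \sum_{k=0}^{A-1} \omega_k^B \operatorname{Log}(u - \omega_k) + C_0,$$ where $\omega_k = \exp(2\pi i k / A)$ ($k = 0, \dots, A-1$) are the distinct complex $A$-th roots of unity, $\operatorname{Log}$ denotes the principal complex logarithm, and $C_0$ is a constant (independent of $y$) chosen so that $F_\alpha(0) = 0$.
   Context: An empty sum (when $B-1 < A$) is $0$. The principal logarithm is $\operatorname{Log} z = \ln|z| + i \arg z$ with $\arg z \in (-\pi, \pi]$, so that on negative reals $\operatorname{Log}(x) = \ln|x| + i\pi$. The constant $C_0$ may be complex. *)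

theory Defs
  imports "HOL-Analysis.Analysis"
begin

definition F :: "real \<Rightarrow> real \<Rightarrow> real" where
  "F \<alpha> y = integral {0..y} (\<lambda>s. 1 / (1 - s powr \<alpha>))"

(* The integral defining F exists on the range of y in question,
   so that F never takes the default value of integral. *)
lemma F_integrable:
  fixes \<alpha> y :: real
  assumes "\<alpha> > 0" "0 \<le> y" "y < 1"
  shows "(\<lambda>s. 1 / (1 - s powr \<alpha>)) integrable_on {0..y}"
proof (rule integrable_continuous_real)
  have "s powr \<alpha> < 1" if "s \<in> {0..y}" for s
    using powr_less_mono2[of \<alpha> s 1] that assms by auto
  then show "continuous_on {0..y} (\<lambda>s. 1 / (1 - s powr \<alpha>))"
    using assms by (intro continuous_intros continuous_on_powr') force+
qed

lemma F_0: "F \<alpha> 0 = 0"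
  by (simp add: F_def)

definition \<omega> :: "nat \<Rightarrow> nat \<Rightarrow> complex" where
  "\<omega> A k = exp (2 * complex_of_real pi * \<i> * of_nat k / of_nat A)"

lemma bij_betw_\<omega>:
  assumes "A > 0"
  shows "bij_betw (\<omega> A) {..<A} {z. z ^ A = 1}"
proof -
  have "\<omega> A = (\<lambda>k. cis (2 * pi * real k / real A))"
    by (simp add: \<omega>_def cis_conv_exp fun_eq_iff mult_ac)
  then show ?thesis
    using Complex.bij_betw_roots_unity[OF assms] by simp
qed

(* The right-hand side without its additive constant. The subtraction B - k * A
   does not truncate, since k \<le> (B - 1) div A forces k * A < B. The library's
   Ln has imaginary part in (-pi, pi], hence Ln x = ln |x| + i pi for real x < 0. *)
definition F_explicit :: "nat \<Rightarrow> nat \<Rightarrow> real \<Rightarrow> complex" where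
  "F_explicit A B y =
    (let u = y powr (1 / real B) in
      - (\<Sum>k = 1..(B - 1) div A.
           complex_of_real (real B * u ^ (B - k * A) / real (B - k * A)))
      - of_nat B / of_nat A * (\<Sum>k<A. \<omega> A k ^ B * Ln (complex_of_real u - \<omega> A k)))"

end

theory Submission
  imports Defs
begin

text \<open>
  Put \<open>s = u ^ B\<close>. The integrand becomes \<open>B * u ^ (B - 1) / (1 - u ^ A)\<close>; polynomial division by
  \<open>1 - u ^ A\<close> leaves the remainder \<open>u ^ m\<close> with \<open>m = (B - 1) mod A\<close>, which is split over the
  roots of unity, the coefficients coming from the orthogonality of their powers. Each
  \<open>Ln (u - \<omega> A k)\<close> is smooth on \<open>0 \<le> u < 1\<close>: for non-real \<open>\<omega> A k\<close> the argument keeps a fixed nonzero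
  imaginary part, for \<open>\<omega> A k = -1\<close> it is positive, and for \<open>\<omega> A k = 1\<close> it stays on the negative
  real axis, where \<open>Ln\<close> is \<open>ln \<bar>x\<bar> + \<i> * pi\<close>.
\<close>

lemma \<omega>_power: "A > 0 \<Longrightarrow> \<omega> A k ^ A = 1"
  using complex_root_unity[of A k] by (simp add: \<omega>_def)

lemma norm_\<omega>: "norm (\<omega> A k) = 1"
  by (simp add: \<omega>_def)

text \<open>Since \<open>\<omega> A k ^ n = \<omega> A n ^ k\<close>, this is a geometric sum whose
  ratio is itself an \<open>A\<close>-th root of unity, equal to 1 exactly when
  \<open>A dvd n\<close>.\<close>

lemma sum_\<omega>_power:
  assumes "A > 0"
  shows "(\<Sum>k<A. \<omega> A k ^ n) = (if A dvd n then of_nat A else 0)"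
proof -
  have eq: "\<omega> A k ^ n = \<omega> A n ^ k" for k
    by (simp add: \<omega>_def flip: exp_of_nat_mult) (simp add: mult_ac)
  have one: "\<omega> A n = 1 \<longleftrightarrow> A dvd n"
    using complex_root_unity_eq_1[of A n] assms by (simp add: \<omega>_def)
  show ?thesis
  proof (cases "A dvd n")
    case True
    then have "\<omega> A n = 1" by (simp add: one)
    then show ?thesis using True by (simp add: eq)
  next
    case False
    then show ?thesis
      using one \<omega>_power[OF assms, of n] by (simp add: eq sum_gp_strict)
  qed
qed

text \<open>Because \<open>\<omega> A k ^ A = 1\<close>, each quotient of \<open>1 - u ^ A\<close>
  by \<open>u - \<omega> A k\<close> is a polynomial in \<open>u\<close>. Summing over
  \<open>k\<close> first, orthogonality leaves a single power of \<open>u\<close>. The bound on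
  \<open>norm u\<close> keeps the denominators nonzero.\<close>

lemma partial_fraction_remainder:
  fixes u :: complex
  assumes "A > 0" "B > 0" "norm u < 1"
  shows "(1 - u ^ A) * (\<Sum>k<A. \<omega> A k ^ B / (u - \<omega> A k)) = - of_nat A * u ^ ((B - 1) mod A)"
proof -
  let ?m = "(B - 1) mod A"
  \<comment> \<open>The exponent is congruent to \<open>B - 1 - i\<close> modulo \<open>A\<close>;
    passing to \<open>int\<close> avoids truncated subtraction.\<close>
  have dvd: "A dvd B + (A - Suc i) \<longleftrightarrow> i = ?m" if "i < A" for i
  proof -
    have "int (B + (A - Suc i)) = int A + (int (B - 1) - int i)"
      using that assms by simp
    then have "A dvd B + (A - Suc i) \<longleftrightarrow> int A dvd int (B - 1) - int i"
      by (metis dvd_add_right_iff dvd_refl int_dvd_int_iff)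
    also have "\<dots> \<longleftrightarrow> (B - 1) mod A = i mod A"
      by (metis mod_eq_dvd_iff of_nat_eq_iff of_nat_mod)
    finally show ?thesis using that by auto
  qed
  have "(1 - u ^ A) * (\<omega> A k ^ B / (u - \<omega> A k)) = - (\<Sum>i<A. \<omega> A k ^ (B + (A - Suc i)) * u ^ i)" for k
  proof -
    have ne: "u - \<omega> A k \<noteq> 0"
      using assms(3) norm_\<omega>[of A k] by auto
    have "u ^ A - 1 = (u - \<omega> A k) * (\<Sum>i<A. \<omega> A k ^ (A - Suc i) * u ^ i)"
      using power_diff_sumr2[of u A "\<omega> A k"] \<omega>_power[OF assms(1), of k] by simp
    then have "(1 - u ^ A) / (u - \<omega> A k) = - (\<Sum>i<A. \<omega> A k ^ (A - Suc i) * u ^ i)"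
      using ne by (simp add: field_simps)
    then have "\<omega> A k ^ B * ((1 - u ^ A) / (u - \<omega> A k))
        = - (\<Sum>i<A. \<omega> A k ^ (B + (A - Suc i)) * u ^ i)"
      by (simp add: sum_distrib_left power_add mult_ac del: add_Suc_right Nat.add_diff_assoc)
    then show ?thesis by (simp add: mult_ac)
  qed
  then have "(1 - u ^ A) * (\<Sum>k<A. \<omega> A k ^ B / (u - \<omega> A k))
      = - (\<Sum>k<A. \<Sum>i<A. \<omega> A k ^ (B + (A - Suc i)) * u ^ i)"
    by (simp only: sum_distrib_left sum_negf)
  also have "\<dots> = - (\<Sum>i<A. (\<Sum>k<A. \<omega> A k ^ (B + (A - Suc i))) * u ^ i)"
    by (subst sum.swap) (simp add: sum_distrib_right)
  also have "\<dots> = - (\<Sum>i<A. if i = ?m then of_nat A * u ^ i else 0)"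
    by (intro arg_cong[where f = uminus] sum.cong) (simp_all add: sum_\<omega>_power[OF assms(1)] dvd del: Nat.add_diff_assoc)
  also have "\<dots> = - of_nat A * u ^ ?m"
    using assms(1) by simp
  finally show ?thesis .
qed

text \<open>The product telescopes. It is applied with \<open>q\<close> and \<open>m\<close> the
  quotient and remainder of \<open>B - 1\<close> by \<open>A\<close>, so that
  \<open>q * A + m = B - 1\<close>. In the induction the term for \<open>k = 1\<close> is split off
  and the others are shifted.\<close>

lemma power_geometric_division:
  fixes u :: "'a::comm_ring_1"
  shows "(1 - u ^ A) * (\<Sum>k = 1..q. u ^ (q * A + m - k * A)) = u ^ m - u ^ (q * A + m)"
proof (induction q)
  case (Suc q)
  have "(\<Sum>k = 1..Suc q. u ^ (Suc q * A + m - k * A))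
      = u ^ (q * A + m) + (\<Sum>k = 1..q. u ^ (q * A + m - k * A))"
    by (subst sum.atLeast_Suc_atMost)
       (simp_all add: sum.shift_bounds_cl_Suc_ivl algebra_simps del: sum.cl_ivl_Suc)
  then have "(1 - u ^ A) * (\<Sum>k = 1..Suc q. u ^ (Suc q * A + m - k * A))
      = (1 - u ^ A) * u ^ (q * A + m) + (u ^ m - u ^ (q * A + m))"
    by (simp only: distrib_left Suc)
  also have "\<dots> = u ^ m - u ^ (Suc q * A + m)"
    by (simp add: left_diff_distrib power_add)
  finally show ?case .
qed simp

text \<open>After multiplication by \<open>1 - u ^ A\<close>, the polynomial part contributes
  \<open>u ^ (B - 1) - u ^ m\<close> and the root sum \<open>u ^ m\<close>, where
  \<open>m = (B - 1) mod A\<close>.\<close>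

lemma partial_fractions:
  fixes u :: complex
  assumes "A > 0" "B > 0" "norm u < 1"
  shows "- (\<Sum>k = 1..(B - 1) div A. u ^ (B - k * A - 1))
      - (\<Sum>k<A. \<omega> A k ^ B / (u - \<omega> A k)) / of_nat A = u ^ (B - 1) / (1 - u ^ A)"
proof -
  let ?q = "(B - 1) div A" and ?m = "(B - 1) mod A"
  have "norm (u ^ A) < 1"
    using assms by (simp add: norm_power power_less_one_iff)
  then have ne: "1 - u ^ A \<noteq> 0" by auto
  let ?P = "\<Sum>k = 1..?q. u ^ (B - k * A - 1)" and ?S = "\<Sum>k<A. \<omega> A k ^ B / (u - \<omega> A k)"
  have "(1 - u ^ A) * (- ?P - ?S / of_nat A)
      = - ((1 - u ^ A) * ?P) - ((1 - u ^ A) * ?S) / of_nat A"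
    by (simp add: right_diff_distrib)
  also have "(1 - u ^ A) * ?P = u ^ ?m - u ^ (B - 1)"
    using power_geometric_division[of u A ?q ?m] by (simp add: diff_commute)
  also have "(1 - u ^ A) * ?S = - of_nat A * u ^ ?m"
    by (rule partial_fraction_remainder[OF assms])
  finally have "(1 - u ^ A) * (- ?P - ?S / of_nat A) = u ^ (B - 1)"
    using assms(1) by simp
  then show ?thesis
    unfolding nonzero_eq_divide_eq[OF ne] by (subst mult.commute)
qed

text \<open>The derivative is taken along the real line because for \<open>w = 1\<close> the
  argument runs inside the branch cut, where \<open>Ln\<close> has no complex derivative.\<close>

lemma Ln_sub_unit_has_vector_derivative:
  fixes w :: complex and u :: real
  assumes "norm w = 1" "0 \<le> u" "u < 1"
  shows "((\<lambda>t. Ln (complex_of_real t - w)) has_vector_derivative 1 / (of_real u - w)) (at u)"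
proof (cases "w = 1")
  case True
  have "((\<lambda>t. complex_of_real (ln (1 - t)) + \<i> * pi) has_vector_derivative of_real (-1 / (1 - u)) + 0) (at u)"
    using assms
    by (intro has_vector_derivative_add has_vector_derivative_of_real has_vector_derivative_const)
       (auto intro!: derivative_eq_intros simp flip: has_real_derivative_iff_has_vector_derivative)
  moreover have "complex_of_real (ln (1 - t)) + \<i> * pi = Ln (complex_of_real t - w)" if "t < 1" for t
  proof -
    have "Ln (complex_of_real t - w) = Ln (- complex_of_real (1 - t))"
      using True by simp
    also have "\<dots> = Ln (complex_of_real (1 - t)) + \<i> * pi"
      using that by (subst Ln_minus) (auto simp: complex_is_Real_iff)
    also have "\<dots> = complex_of_real (ln (1 - t)) + \<i> * pi"
      using that by (subst Ln_of_real) auto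
    finally show ?thesis by simp
  qed
  ultimately have "((\<lambda>t. Ln (complex_of_real t - w)) has_vector_derivative of_real (-1 / (1 - u)) + 0) (at u)"
    using assms(3) by (elim has_vector_derivative_transform_within_open[where S = "{..<1}"]) auto
  moreover have "of_real (-1 / (1 - u)) + 0 = 1 / (complex_of_real u - w)"
    using True assms(3) by (simp add: field_simps)
  ultimately show ?thesis by (simp only:)
next
  case False
  \<comment> \<open>A point of the cut would make \<open>w\<close> real with
    \<open>w \<ge> u \<ge> 0\<close>, and the unit norm then leaves only
    \<open>w = 1\<close>.\<close>
  have "complex_of_real u - w \<notin> \<real>\<^sub>\<le>\<^sub>0"
  proof
    assume "complex_of_real u - w \<in> \<real>\<^sub>\<le>\<^sub>0"
    then have "Im w = 0" "u \<le> Re w"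
      by (auto simp: complex_nonpos_Reals_iff)
    then have "w = 1"
      using assms by (auto simp: complex_eq_iff cmod_eq_Re)
    with False show False by simp
  qed
  then have "((\<lambda>z. Ln (z - w)) has_field_derivative 1 / (of_real u - w)) (at (of_real u))"
    by (auto intro!: derivative_eq_intros simp: inverse_eq_divide)
  then show ?thesis
    using has_vector_derivative_real_field by (fastforce simp: o_def)
qed

text \<open>In the variable \<open>u\<close> the formula is differentiable at 0 as well, whereas
  \<open>y powr (1 / real B)\<close> need not be.\<close>

definition F_root :: "nat \<Rightarrow> nat \<Rightarrow> real \<Rightarrow> complex" where
  "F_root A B u =
    - (\<Sum>k = 1..(B - 1) div A. complex_of_real (real B * u ^ (B - k * A) / real (B - k * A)))
    - of_nat B / of_nat A * (\<Sum>k<A. \<omega> A k ^ B * Ln (complex_of_real u - \<omega> A k))"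

lemma F_explicit_eq_F_root: "F_explicit A B y = F_root A B (y powr (1 / real B))"
  by (simp only: F_explicit_def F_root_def Let_def)

text \<open>Termwise differentiation gives \<open>B\<close> times the left-hand side of
  \<open>partial_fractions\<close>.\<close>

lemma F_root_has_vector_derivative:
  assumes "A > 0" "B > 0" "0 \<le> u" "u < 1"
  shows "(F_root A B has_vector_derivative of_real (B * u ^ (B - 1) / (1 - u ^ A))) (at u)"
proof -
  let ?U = "complex_of_real u"
  have mono: "((\<lambda>t. complex_of_real (real B * t ^ (B - k * A) / real (B - k * A)))
      has_vector_derivative of_real (B * u ^ (B - k * A - 1))) (at u)"
    if "k \<in> {1..(B - 1) div A}" for k
  proof -
    have "k * A \<le> B - 1"
      using that assms(1) by (simp add: less_eq_div_iff_mult_less_eq)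
    then have pos: "real (B - k * A) > 0" using assms(2) by linarith
    have "((\<lambda>t. real B * t ^ (B - k * A) / real (B - k * A)) has_real_derivative
        real B * (real (B - k * A) * u ^ (B - k * A - 1)) / real (B - k * A)) (at u)"
      by (intro DERIV_cdivide DERIV_cmult) (auto intro!: derivative_eq_intros)
    also have "real B * (real (B - k * A) * u ^ (B - k * A - 1)) / real (B - k * A) = B * u ^ (B - k * A - 1)"
      using pos by (simp del: of_nat_diff)
    finally show ?thesis
      by (intro has_vector_derivative_of_real)
         (simp only: has_real_derivative_iff_has_vector_derivative)
  qed
  have "(F_root A B has_vector_derivative
      - (\<Sum>k = 1..(B - 1) div A. complex_of_real (B * u ^ (B - k * A - 1)))
      - of_nat B / of_nat A * (\<Sum>k<A. \<omega> A k ^ B * (1 / (?U - \<omega> A k)))) (at u)"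
    unfolding F_root_def
    by (intro has_vector_derivative_diff has_vector_derivative_minus has_vector_derivative_sum mono
          has_vector_derivative_mult_right Ln_sub_unit_has_vector_derivative norm_\<omega> assms)
  also have "- (\<Sum>k = 1..(B - 1) div A. complex_of_real (B * u ^ (B - k * A - 1)))
      - of_nat B / of_nat A * (\<Sum>k<A. \<omega> A k ^ B * (1 / (?U - \<omega> A k)))
      = of_nat B * (- (\<Sum>k = 1..(B - 1) div A. ?U ^ (B - k * A - 1))
          - (\<Sum>k<A. \<omega> A k ^ B / (?U - \<omega> A k)) / of_nat A)"
    by (simp add: right_diff_distrib sum_distrib_left left_diff_distrib sum_divide_distrib mult.commute)
  also have "\<dots> = of_real (B * u ^ (B - 1) / (1 - u ^ A))"
    using assms by (subst partial_fractions) auto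
  finally show ?thesis .
qed

text \<open>This covers the endpoint \<open>y = 0\<close>, which the derivative lemma below
  excludes.\<close>

lemma F_explicit_continuous_on:
  assumes "A > 0" "B > 0"
  shows "continuous_on {0..<1} (F_explicit A B)"
proof -
  have "continuous_on {0..<1} (F_root A B)"
    using F_root_has_vector_derivative[OF assms]
    by (auto intro!: continuous_at_imp_continuous_on has_vector_derivative_continuous)
  moreover have "continuous_on {0..<1} (\<lambda>y::real. y powr (1 / real B))"
    using assms by (intro continuous_on_powr' continuous_intros) auto
  moreover have "(\<lambda>y. y powr (1 / real B)) ` {0..<1} \<subseteq> {0..<1}"
    using assms powr_less_mono2[of "1 / real B" _ 1] by auto
  ultimately show ?thesis
    unfolding F_explicit_eq_F_root by (rule continuous_on_compose2)
qed

lemma F_explicit_has_vector_derivative: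
  assumes "A > 0" "B > 0" "0 < y" "y < 1"
  shows "(F_explicit A B has_vector_derivative of_real (1 / (1 - y powr (real A / real B)))) (at y)"
proof -
  define u where "u = y powr (1 / real B)"
  have u: "0 < u" "u < 1"
    using assms powr_less_mono2[of "1 / real B" y 1] by (auto simp: u_def)
  have uB: "u ^ B = y" and uA: "u ^ A = y powr (real A / real B)"
    using assms by (simp_all add: u_def powr_powr flip: powr_realpow)
  have "((\<lambda>y. y powr (1 / real B)) has_vector_derivative u / (B * y)) (at y)"
    unfolding has_real_derivative_iff_has_vector_derivative[symmetric]
    using assms by (auto intro!: derivative_eq_intros simp: u_def powr_diff)
  moreover have "(F_root A B has_vector_derivative of_real (B * u ^ (B - 1) / (1 - u ^ A)))
      (at (y powr (1 / real B)))"
    using F_root_has_vector_derivative[of A B u] assms u by (simp add: u_def)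
  ultimately have "(F_root A B \<circ> (\<lambda>y. y powr (1 / real B)) has_vector_derivative
      (u / (B * y)) *\<^sub>R of_real (B * u ^ (B - 1) / (1 - u ^ A))) (at y)"
    by (rule vector_diff_chain_at)
  \<comment> \<open>The factor \<open>u / (B * y)\<close> is the derivative of the
    \<open>B\<close>-th root; \<open>u ^ B = y\<close> cancels it against
    \<open>B * u ^ (B - 1)\<close>.\<close>
  moreover have "u / (B * y) * (B * u ^ (B - 1) / (1 - u ^ A)) = 1 / (1 - y powr (real A / real B))"
  proof -
    have "u * u ^ (B - 1) = y"
      using uB assms(2) by (simp add: power_eq_if)
    then have "u / (B * y) * (B * u ^ (B - 1) / (1 - u ^ A)) = y * B / (B * y) / (1 - u ^ A)"
      by (simp add: mult_ac)
    then show ?thesis using assms uA by simp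
  qed
  moreover have "F_root A B \<circ> (\<lambda>y. y powr (1 / real B)) = F_explicit A B"
    by (simp add: fun_eq_iff F_explicit_eq_F_root)
  ultimately show ?thesis
    by (simp only: scaleR_conv_of_real of_real_mult[symmetric])
qed

theorem proposition1:
  fixes A B :: nat and \<alpha> :: real
  assumes "A > 0" and "B > 0" and "coprime A B"
    and "\<alpha> = real A / real B"
  shows "\<exists>C\<^sub>0 :: complex.
    F_explicit A B 0 + C\<^sub>0 = 0 \<and>
    (\<forall>y \<in> {0..<1}. complex_of_real (F \<alpha> y) = F_explicit A B y + C\<^sub>0)"
\<comment> \<open>The normalisation at \<open>y = 0\<close> forces this witness.\<close>
proof (intro exI[of _ "- F_explicit A B 0"] conjI ballI)
  fix y :: real
  assume y: "y \<in> {0..<1}"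
  let ?f = "\<lambda>s. 1 / (1 - s powr \<alpha>)"
  \<comment> \<open>The interior form of the fundamental theorem asks for continuity on
    \<open>{0..y}\<close> but for the derivative only inside.\<close>
  have "((\<lambda>s. complex_of_real (?f s)) has_integral F_explicit A B y - F_explicit A B 0) {0..y}"
    unfolding assms(4) using y assms(1,2)
    by (intro fundamental_theorem_of_calculus_interior
          continuous_on_subset[OF F_explicit_continuous_on] F_explicit_has_vector_derivative) auto
  moreover have "((\<lambda>s. complex_of_real (?f s)) has_integral of_real (F \<alpha> y)) {0..y}"
    unfolding F_def using y assms by (intro has_integral_of_real integrable_integral F_integrable) auto
  ultimately have "F_explicit A B y - F_explicit A B 0 = of_real (F \<alpha> y)"
    by (rule has_integral_unique)
  then show "complex_of_real (F \<alpha> y) = F_explicit A B y + - F_explicit A B 0"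
    by simp
qed simp

end
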